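(* For every integer $k\ge 2$, the sequence $(H_n^{(k)})_{n\ge 0}$ satisfies the following (all variables are integers). (i) For all $0\le m\le r\le k-2$, $H_{mk+r}^{(k)}=0$. (ii) For all $m\in[1,k-1]$, $H_{mk-1}^{(k)}=2^{m-1}$. (iii) For all $0\le r<m\le k-1$, $$H_{mk+r}^{(k)}=(-1)^{r+1}\left[\binom{m-1}{r}+\binom{m}{r+1}\right]2^{m-r-2}.$$ (iv) For all $r\in[-1,k-2]$ and $m\ge k-1$, $$H_{mk+r}^{(k)}=\sum_{i=0}^{l}(-1)^{ik+r+1}\left[\binom{m-i-1}{ik+r}+\binom{m-i}{ik+r+1}\right]2^{m-i(k+1)-r-2},$$ where $l=m-1$ if $k=2$, and $l=\lfloor m/(k-1)\rfloor$ if $k>2$.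
   Context: For an integer $k\ge 2$, the $k$-generalized Fibonacci sequence $(F_n^{(k)})_{n\in\mathbb{Z}}$ is defined by $F_{-i}^{(k)}=0$ for $i=0,1,\dots,k-2$, $F_1^{(k)}=1$, and $F_n^{(k)}=F_{n-1}^{(k)}+\cdots+F_{n-k}^{(k)}$, extended to all integer indices by this recurrence. Put $H_n^{(k)}=F_{-n}^{(k)}$ for $n\ge 0$. Equivalently, $H_i^{(k)}=0$ for $0\le i\le k-2$, $H_{k-1}^{(k)}=1$, and $H_n^{(k)}=H_{n-k}^{(k)}-H_{n-(k-1)}^{(k)}-\cdots-H_{n-1}^{(k)}$ for all $n\ge k$. Binomial coefficients $\binom{v}{w}$ with $v\ge 0$ are $0$ when $w<0$ or $w>v$. Powers of $2$ with negative exponents are rational numbers, so the identities hold in $\mathbb{Q}$. *)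

theory Defs
  imports Complex_Main
begin

(* Value 0 for k < 2 is a dummy.  The last branch solves the recurrence
   F (n + k) = F (n + k - 1) + ... + F n  for its last summand. *)
function gen_fib :: "int \<Rightarrow> int \<Rightarrow> int" where
  "gen_fib k n =
    (if k < 2 then 0
     else if 2 - k \<le> n \<and> n \<le> 0 then 0
     else if n = 1 then 1
     else if n > 1 then (\<Sum>j\<in>{1..k}. gen_fib k (n - j))
     else gen_fib k (n + k) - (\<Sum>j\<in>{1..k - 1}. gen_fib k (n + j)))"
  by auto
termination
  by (relation "measure (\<lambda>(k, n). if n > 1 then nat (n - 1)
        else if n < 2 - k then nat (2 - k - n) else 0)") auto

declare gen_fib.simps [simp del]

lemma gen_fib_init:
  assumes "k \<ge> 2"
  shows "0 \<le> i \<Longrightarrow> i \<le> k - 2 \<Longrightarrow> gen_fib k (- i) = 0" and "gen_fib k 1 = 1"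
  using assms by (simp_all add: gen_fib.simps)

lemma sum_reflect_int:
  fixes f :: "int \<Rightarrow> int"
  shows "(\<Sum>j\<in>{1..k - 1}. f (n - k + j)) = (\<Sum>j\<in>{1..k - 1}. f (n - j))"
  by (rule sum.reindex_bij_witness[where i = "\<lambda>j. k - j" and j = "\<lambda>j. k - j"])
     (auto simp: algebra_simps)

lemma sum_last_int:
  fixes f :: "int \<Rightarrow> int" and k :: int
  assumes "k \<ge> 2"
  shows "(\<Sum>j\<in>{1..k}. f j) = (\<Sum>j\<in>{1..k - 1}. f j) + f k"
proof -
  have "{1..k} = insert k {1..k - 1}" using assms by auto
  then show ?thesis by simp
qed

lemma gen_fib_rec:
  assumes "k \<ge> 2"
  shows "gen_fib k n = (\<Sum>j\<in>{1..k}. gen_fib k (n - j))"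
proof (cases "n > 1")
  case True
  then show ?thesis by (subst gen_fib.simps) (use assms in auto)
next
  case False
  have "gen_fib k (n - k) = gen_fib k n - (\<Sum>j\<in>{1..k - 1}. gen_fib k (n - k + j))"
    by (subst gen_fib.simps) (use assms False in auto)
  then show ?thesis
    using assms by (simp add: sum_reflect_int sum_last_int)
qed

lemma gen_fib_unique:
  fixes F :: "int \<Rightarrow> int"
  assumes "k \<ge> 2"
    and "\<And>i. 0 \<le> i \<Longrightarrow> i \<le> k - 2 \<Longrightarrow> F (- i) = 0"
    and "F 1 = 1"
    and "\<And>n. F n = (\<Sum>j\<in>{1..k}. F (n - j))"
  shows "F = gen_fib k"
proof
  fix n
  define R where "R k \<longleftrightarrow> k \<ge> 2 \<and> (\<forall>i. 0 \<le> i \<and> i \<le> k - 2 \<longrightarrow> F (- i) = 0) \<and> F 1 = 1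
    \<and> (\<forall>n. F n = (\<Sum>j\<in>{1..k}. F (n - j)))" for k
  have "R k" unfolding R_def using assms by blast
  then show "F n = gen_fib k n"
  proof (induction k n rule: gen_fib.induct)
    case (1 k n)
    have k: "k \<ge> 2" and init: "\<And>i. 0 \<le> i \<Longrightarrow> i \<le> k - 2 \<Longrightarrow> F (- i) = 0"
      and one: "F 1 = 1" and rec: "\<And>n. F n = (\<Sum>j\<in>{1..k}. F (n - j))"
      using "1.prems" unfolding R_def by blast+
    consider "2 - k \<le> n" "n \<le> 0" | "n = 1" | "n > 1" | "n < 2 - k" by linarith
    then show ?case
    proof cases
      case 1
      then show ?thesis
        using init[of "- n"] gen_fib_init(1)[OF k, of "- n"] by simp
    next
      case 2
      then show ?thesis using one gen_fib_init(2)[OF k] by simp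
    next
      case 3
      have "F n = (\<Sum>j\<in>{1..k}. F (n - j))" by (rule rec)
      also have "\<dots> = (\<Sum>j\<in>{1..k}. gen_fib k (n - j))"
        by (rule sum.cong[OF refl], rule "1.IH"(1)) (use 3 k "1.prems" in auto)
      also have "\<dots> = gen_fib k n" by (rule gen_fib_rec[OF k, symmetric])
      finally show ?thesis .
    next
      case 4
      have A: "F (n + k) = gen_fib k (n + k)"
        by (rule "1.IH"(2)) (use 4 k "1.prems" in auto)
      have B: "(\<Sum>j\<in>{1..k - 1}. F (n + j)) = (\<Sum>j\<in>{1..k - 1}. gen_fib k (n + j))"
        by (rule sum.cong[OF refl], rule "1.IH"(3)) (use 4 k "1.prems" in auto)
      have C: "G (n + k) = (\<Sum>j\<in>{1..k - 1}. G (n + j)) + G n"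
        if "G (n + k) = (\<Sum>j\<in>{1..k}. G (n + k - j))" for G :: "int \<Rightarrow> int"
        using that sum_last_int[OF k, of "\<lambda>j. G (n + k - j)"]
          sum_reflect_int[of G "n + k" k] by simp
      show ?thesis
        using C[of F, OF rec] C[of "gen_fib k", OF gen_fib_rec[OF k]] A B by linarith
    qed
  qed
qed

definition gen_fib_neg :: "int \<Rightarrow> int \<Rightarrow> int" where
  "gen_fib_neg k n = gen_fib k (- n)"

lemma gen_fib_neg_init:
  assumes "k \<ge> 2"
  shows "0 \<le> i \<Longrightarrow> i \<le> k - 2 \<Longrightarrow> gen_fib_neg k i = 0" and "gen_fib_neg k (k - 1) = 1"
proof -
  show "0 \<le> i \<Longrightarrow> i \<le> k - 2 \<Longrightarrow> gen_fib_neg k i = 0"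
    using assms by (simp add: gen_fib_neg_def gen_fib_init)
  have "(\<Sum>j\<in>{1..k - 1}. gen_fib k (1 - k + j)) = 0"
    by (rule sum.neutral) (use assms in \<open>auto simp: gen_fib.simps\<close>)
  then show "gen_fib_neg k (k - 1) = 1"
    using assms by (simp add: gen_fib_neg_def gen_fib.simps[of k "1 - k"] gen_fib_init)
qed

lemma gen_fib_neg_rec:
  assumes "k \<ge> 2"
  shows "gen_fib_neg k n = gen_fib_neg k (n - k) - (\<Sum>j\<in>{1..k - 1}. gen_fib_neg k (n - j))"
  using gen_fib_rec[OF assms, of "k - n"] sum_last_int[OF assms, of "\<lambda>j. gen_fib k (k - n - j)"]
    sum_reflect_int[of "gen_fib k" "k - n" k]
  by (simp add: gen_fib_neg_def algebra_simps)

definition int_binom :: "int \<Rightarrow> int \<Rightarrow> int" where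
  "int_binom v w = (if 0 \<le> w \<and> w \<le> v then int (nat v choose nat w) else 0)"

end

(* Subtracting two consecutive instances of the recurrence leaves the three-term one
   H n = 2 H (n - k) - H (n - k - 1), so the generating function of H is
   x^(k-1) (1 - x) / (1 - x^k (2 - x)).  In the geometric expansion of this fraction, the
   coefficients of (1 - x) (2 - x)^(v-1) are the terms fib_term v w below, whence
   H n is the sum of fib_term v w over v >= 1 and v k + w = n + 1.  All four parts are this one
   formula, truncated to the range in which fib_term v w can be nonzero. *)
theory Submission
  imports Defs
begin

section \<open>The three-term recurrence\<close>

text \<open>No lower bound on \<open>n\<close>: the defining recurrence is two-sided. The case
  \<open>n = k\<close> is needed later and reaches the index -1.\<close>

lemma gen_fib_neg_three_term:
  assumes "k \<ge> 2"
  shows "gen_fib_neg k n = 2 * gen_fib_neg k (n - k) - gen_fib_neg k (n - k - 1)"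
proof -
  let ?H = "gen_fib_neg k"
  have "{1..k} = insert 1 {2..k}"
    using assms by auto
  then have "(\<Sum>j\<in>{1..k}. ?H (n - j)) = ?H (n - 1) + (\<Sum>j\<in>{2..k}. ?H (n - j))"
    by simp
  also have "(\<Sum>j\<in>{2..k}. ?H (n - j)) = (\<Sum>j\<in>{1..k - 1}. ?H (n - 1 - j))"
    by (rule sum.reindex_bij_witness[where i = "\<lambda>j. j + 1" and j = "\<lambda>j. j - 1"])
       (auto simp: algebra_simps)
  finally show ?thesis
    using gen_fib_neg_rec[OF assms, of n] gen_fib_neg_rec[OF assms, of "n - 1"]
      sum_last_int[OF assms, of "\<lambda>j. ?H (n - j)"]
    by (simp add: algebra_simps)
qed

section \<open>Coefficients of (1 - x) (2 - x)^(v-1)\<close>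

text \<open>Pascal's rule with zero outside the triangle; it breaks at \<open>v = w = 0\<close>,
  where the left side is 1 and the right side 0.\<close>

lemma int_binom_pascal:
  assumes "v \<ge> 1"
  shows "int_binom v w = int_binom (v - 1) w + int_binom (v - 1) (w - 1)"
proof (cases "1 \<le> w \<and> w \<le> v")
  case True
  then obtain a b where a: "v = 1 + int a" and b: "w = 1 + int b"
    using assms by (metis zle_iff_zadd)
  show ?thesis
    using True by (auto simp: a b int_binom_def nat_add_distrib nat_diff_distrib binomial_eq_0)
next
  case False
  then show ?thesis
    using assms by (auto simp: int_binom_def)
qed

text \<open>For \<open>v \<ge> 1\<close> the coefficient of x^w in (1 - x) (2 - x)^(v-1): Pascal's
  rule turns C(v-1,w) + 2 C(v-1,w-1) into the bracket. The values are typed as rationals because the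
  exponent of 2 is -1 at \<open>w = v\<close>.\<close>

definition fib_term :: "int \<Rightarrow> int \<Rightarrow> rat" where
  "fib_term v w = (-1) powi w * of_int (int_binom (v - 1) (w - 1) + int_binom v w) * 2 powi (v - w - 1)"

lemma fib_term_eq_0: "w < 0 \<or> v < w \<Longrightarrow> fib_term v w = 0"
  by (auto simp: fib_term_def int_binom_def)

lemma fib_term_1: "fib_term 1 w = (if w = 0 then 1 else if w = 1 then -1 else 0)"
  by (auto simp: fib_term_def int_binom_def power_int_minus)

text \<open>Raising \<open>v\<close> by one multiplies the polynomial by 2 - x.\<close>

lemma fib_term_rec:
  assumes "v \<ge> 2"
  shows "fib_term v w = 2 * fib_term (v - 1) w - fib_term (v - 1) (w - 1)"
proof -
  have sgn: "(-1 :: rat) powi (w - 1) = - ((-1) powi w)"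
    by (simp add: power_int_diff)
  \<comment> \<open>With \<open>2 powi (v - w - 2)\<close> as common factor, the claim reduces to
    Pascal's rule for both binomials of the bracket.\<close>
  have pow: "(2 :: rat) powi (v - w - 1) = 2 * 2 powi (v - w - 2)"
    using power_int_add_1'[of "2 :: rat" "v - w - 2"] by simp
  have "int_binom v w = int_binom (v - 1) w + int_binom (v - 1) (w - 1)"
    "int_binom (v - 1) (w - 1) = int_binom (v - 2) (w - 1) + int_binom (v - 2) (w - 2)"
    using assms int_binom_pascal[of v w] int_binom_pascal[of "v - 1" "w - 1"] by simp_all
  moreover have "v - 1 - w - 1 = v - w - 2" "v - 1 - (w - 1) - 1 = v - w - 1"
    "v - 1 - 1 = v - 2" "w - 1 - 1 = w - 2"
    by simp_all
  ultimately show ?thesis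
    unfolding fib_term_def sgn pow by (simp only: sgn pow of_int_add) (simp add: algebra_simps)
qed

section \<open>Identification with the coefficients of the generating function\<close>

text \<open>For \<open>k \<ge> 1\<close> the bound \<open>n + 1\<close> covers every
  \<open>v\<close> with \<open>v * k \<le> n + 1\<close> without a division, and makes the sum empty
  for negative \<open>n\<close>. The start at 1 matters: \<open>fib_term 0 0\<close> is 1/2.\<close>

definition fib_sum :: "int \<Rightarrow> int \<Rightarrow> rat" where
  "fib_sum k n = (\<Sum>v\<in>{1..n + 1}. fib_term v (n + 1 - v * k))"

text \<open>Past \<open>n + 1\<close> the second argument of \<open>fib_term\<close> is negative.
  This lets sums for different \<open>n\<close> share one range.\<close>

lemma fib_sum_eq:
  assumes "k \<ge> 1" "n + 1 \<le> N"
  shows "fib_sum k n = (\<Sum>v\<in>{1..N}. fib_term v (n + 1 - v * k))"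
  unfolding fib_sum_def
proof (rule sum.mono_neutral_left)
  show "\<forall>v\<in>{1..N} - {1..n + 1}. fib_term v (n + 1 - v * k) = 0"
  proof
    fix v assume v: "v \<in> {1..N} - {1..n + 1}"
    then have "v * 1 \<le> v * k"
      using assms by (intro mult_left_mono) auto
    moreover have "n + 1 < v"
      using v by auto
    ultimately have "n + 1 < v * k"
      by linarith
    then show "fib_term v (n + 1 - v * k) = 0"
      by (intro fib_term_eq_0) auto
  qed
qed (use assms in auto)

text \<open>The term \<open>v = 1\<close>, from the factor 1 - x, is the inhomogeneity; in the
  others one factor 2 - x is split off and \<open>v\<close> shifted down.\<close>

lemma fib_sum_rec:
  assumes "k \<ge> 1" "n \<ge> 0"
  shows "fib_sum k n = fib_term 1 (n + 1 - k) + 2 * fib_sum k (n - k) - fib_sum k (n - k - 1)"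
proof -
  have split: "{1..n + 1} = insert 1 {2..n + 1}"
    using assms by auto
  have "fib_sum k n = fib_term 1 (n + 1 - k) + (\<Sum>v\<in>{2..n + 1}. fib_term v (n + 1 - v * k))"
    unfolding fib_sum_def split by simp
  also have "(\<Sum>v\<in>{2..n + 1}. fib_term v (n + 1 - v * k)) =
      (\<Sum>v\<in>{1..n}. 2 * fib_term v (n - k + 1 - v * k) - fib_term v (n - k - 1 + 1 - v * k))"
    by (rule sum.reindex_bij_witness[where i = "\<lambda>v. v + 1" and j = "\<lambda>v. v - 1"])
       (auto simp: fib_term_rec algebra_simps)
  also have "\<dots> = 2 * fib_sum k (n - k) - fib_sum k (n - k - 1)"
    using assms
    by (simp add: fib_sum_eq[of k "n - k" n] fib_sum_eq[of k "n - k - 1" n] sum_subtractf sum_distrib_left)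
  finally show ?thesis
    by simp
qed

lemma gen_fib_neg_eq_fib_sum:
  assumes "k \<ge> 2" "n \<ge> 0"
  shows "of_int (gen_fib_neg k n) = fib_sum k n"
  using assms(2)
proof (induction "nat n" arbitrary: n rule: less_induct)
  case less
  have IH: "of_int (gen_fib_neg k i) = fib_sum k i" if "0 \<le> i" "i < n" for i
    using less.hyps[of i] that by simp
  have neg: "fib_sum k i = 0" if "i < 0" for i
    using that by (simp add: fib_sum_def)
  have rec: "fib_sum k n = fib_term 1 (n + 1 - k) + 2 * fib_sum k (n - k) - fib_sum k (n - k - 1)"
    using assms less.prems by (intro fib_sum_rec) auto
  consider "n < k - 1" | "n = k - 1" | "n = k" | "n > k"
    by linarith
  then show ?case
  proof cases
    case 1
    then show ?thesis
      using rec neg less.prems gen_fib_neg_init(1)[OF assms(1), of n] by (simp add: fib_term_1)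
  next
    case 2
    then show ?thesis
      using rec neg gen_fib_neg_init(2)[OF assms(1)] by (simp add: fib_term_1)
  next
    case 3
    \<comment> \<open>The two sequences differ at -1: here the value is F_1 = 1, while
      \<open>fib_sum k (-1) = 0\<close>. At \<open>n = k\<close> the inhomogeneity
      \<open>fib_term 1 1 = -1\<close> makes up for it.\<close>
    have "gen_fib_neg k (-1) = 1"
      using gen_fib_init(2)[OF assms(1)] by (simp add: gen_fib_neg_def)
    moreover have "gen_fib_neg k 0 = 0"
      using gen_fib_neg_init(1)[OF assms(1), of 0] assms(1) by simp
    ultimately show ?thesis
      using rec neg IH[of 0] gen_fib_neg_three_term[OF assms(1), of k] assms(1) 3
      by (simp add: fib_term_1)
  next
    case 4
    then show ?thesis
      using rec assms(1) IH[of "n - k"] IH[of "n - k - 1"]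
      by (simp add: fib_term_1 gen_fib_neg_three_term[OF assms(1), of n])
  qed
qed

text \<open>Substitute \<open>v = m - i\<close>, so that w becomes \<open>i * k + r + 1\<close>.
  Indices \<open>v > m\<close> give w < 0 because \<open>r \<le> k - 2\<close>; indices
  \<open>i > L\<close> exceed the degree by assumption. Each part of the theorem is a choice of
  \<open>L\<close>.\<close>

lemma gen_fib_neg_expansion:
  assumes "k \<ge> 2" "m \<ge> 1" "-1 \<le> r" "r \<le> k - 2"
    and L: "\<And>i. 0 \<le> i \<Longrightarrow> L < i \<Longrightarrow> m - i < i * k + r + 1"
  shows "of_int (gen_fib_neg k (m * k + r)) = (\<Sum>i\<in>{0..L}. fib_term (m - i) (i * k + r + 1))"
proof -
  have mk: "m * 2 \<le> m * k"
    using assms by (intro mult_left_mono) auto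
  have "of_int (gen_fib_neg k (m * k + r)) = fib_sum k (m * k + r)"
    using mk assms by (intro gen_fib_neg_eq_fib_sum) linarith+
  also have "\<dots> = (\<Sum>v\<in>{m - L..m}. fib_term v ((m - v) * k + r + 1))"
    unfolding fib_sum_def
  proof (rule sum.mono_neutral_cong)
    \<comment> \<open>A large \<open>L\<close> admits \<open>v \<le> 0\<close>, outside
      \<open>fib_sum\<close>; there w is at least \<open>k\<close>, so these terms vanish.\<close>
    fix v assume "v \<in> {m - L..m} - {1..m * k + r + 1}"
    moreover have "m \<le> m * k + r + 1"
      using mk assms by linarith
    ultimately have "v \<le> 0"
      by auto
    then have "1 * k \<le> (m - v) * k"
      using assms by (intro mult_right_mono) auto
    then have "v < (m - v) * k + r + 1"
      using \<open>v \<le> 0\<close> assms by linarith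
    then show "fib_term v ((m - v) * k + r + 1) = 0"
      by (intro fib_term_eq_0) auto
  next
    fix v assume v: "v \<in> {1..m * k + r + 1} - {m - L..m}"
    show "fib_term v (m * k + r + 1 - v * k) = 0"
    proof (cases "v > m")
      case True
      then have "1 * k \<le> (v - m) * k"
        using assms by (intro mult_right_mono) auto
      then show ?thesis
        using assms by (intro fib_term_eq_0) (auto simp: algebra_simps)
    next
      case False
      then show ?thesis
        using v L[of "m - v"] by (intro fib_term_eq_0) (auto simp: algebra_simps)
    qed
  qed (auto simp: algebra_simps)
  also have "\<dots> = (\<Sum>i\<in>{0..L}. fib_term (m - i) (i * k + r + 1))"
    by (rule sum.reindex_bij_witness[where i = "\<lambda>i. m - i" and j = "\<lambda>v. m - v"]) auto
  finally show ?thesis .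
qed

section \<open>The four formulas as truncations\<close>

theorem theorem1:
  fixes k :: int
  assumes "k \<ge> 2"
  shows
    "(\<forall>m r. 0 \<le> m \<and> m \<le> r \<and> r \<le> k - 2 \<longrightarrow> gen_fib_neg k (m * k + r) = 0) \<and>
     (\<forall>m\<in>{1..k - 1}. (of_int (gen_fib_neg k (m * k - 1)) :: rat) = 2 powi (m - 1)) \<and>
     (\<forall>m r. 0 \<le> r \<and> r < m \<and> m \<le> k - 1 \<longrightarrow>
        (of_int (gen_fib_neg k (m * k + r)) :: rat) =
          (-1) powi (r + 1) * of_int (int_binom (m - 1) r + int_binom m (r + 1))
            * 2 powi (m - r - 2)) \<and>
     (\<forall>r\<in>{-1..k - 2}. \<forall>m\<ge>k - 1.
        let l = (if k = 2 then m - 1 else \<lfloor>(of_int m :: rat) / of_int (k - 1)\<rfloor>)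
        in (of_int (gen_fib_neg k (m * k + r)) :: rat) =
          (\<Sum>i\<in>{0..l}. (-1) powi (i * k + r + 1)
            * of_int (int_binom (m - i - 1) (i * k + r) + int_binom (m - i) (i * k + r + 1))
            * 2 powi (m - i * (k + 1) - r - 2)))"
proof (intro conjI allI ballI impI)
  fix m r assume A: "0 \<le> m \<and> m \<le> r \<and> r \<le> k - 2"
  show "gen_fib_neg k (m * k + r) = 0"
  proof (cases "m = 0")
    case True
    then show ?thesis
      using A gen_fib_neg_init(1)[OF assms] by simp
  next
    case False
    \<comment> \<open>Since \<open>m \<le> r\<close>, already \<open>i = 0\<close> exceeds the
      degree, so the empty range \<open>L = -1\<close> suffices.\<close>
    have "(of_int (gen_fib_neg k (m * k + r)) :: rat) =
        (\<Sum>i\<in>{0..-1}. fib_term (m - i) (i * k + r + 1))"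
    proof (rule gen_fib_neg_expansion)
      fix i :: int assume "0 \<le> i"
      then have "0 \<le> i * k"
        using assms by simp
      then show "m - i < i * k + r + 1"
        using A \<open>0 \<le> i\<close> by linarith
    qed (use assms A False in auto)
    then show ?thesis
      by simp
  qed
next
  fix m assume m: "m \<in> {1..k - 1}"
  \<comment> \<open>For \<open>r = -1\<close> every \<open>i \<ge> 1\<close> gives w at least
    \<open>k\<close>, hence above \<open>m\<close>; only \<open>fib_term m 0\<close>
    remains.\<close>
  have "(of_int (gen_fib_neg k (m * k + -1)) :: rat) =
      (\<Sum>i\<in>{0..0}. fib_term (m - i) (i * k + -1 + 1))"
  proof (rule gen_fib_neg_expansion)
    fix i :: int assume "0 < i"
    then have "1 * k \<le> i * k"
      using assms by (intro mult_right_mono) auto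
    then show "m - i < i * k + -1 + 1"
      using m \<open>0 < i\<close> unfolding atLeastAtMost_iff by linarith
  qed (use assms m in auto)
  then show "(of_int (gen_fib_neg k (m * k - 1)) :: rat) = 2 powi (m - 1)"
    using m by (simp add: fib_term_def int_binom_def)
next
  fix m r assume A: "0 \<le> r \<and> r < m \<and> m \<le> k - 1"
  have "(of_int (gen_fib_neg k (m * k + r)) :: rat) =
      (\<Sum>i\<in>{0..0}. fib_term (m - i) (i * k + r + 1))"
  proof (rule gen_fib_neg_expansion)
    fix i :: int assume "0 < i"
    then have "1 * k \<le> i * k"
      using assms by (intro mult_right_mono) auto
    then show "m - i < i * k + r + 1"
      using A \<open>0 < i\<close> by linarith
  qed (use assms A in auto)
  then show "(of_int (gen_fib_neg k (m * k + r)) :: rat) =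
      (-1) powi (r + 1) * of_int (int_binom (m - 1) r + int_binom m (r + 1))
        * 2 powi (m - r - 2)"
    by (simp add: fib_term_def algebra_simps)
next
  fix r m assume r: "r \<in> {-1..k - 2}" and m: "k - 1 \<le> m"
  define l where "l = (if k = 2 then m - 1 else \<lfloor>(of_int m :: rat) / of_int (k - 1)\<rfloor>)"
  \<comment> \<open>Either alternative passes the degree: the first gives
    \<open>m - i < i * (k - 2)\<close>, which is at most \<open>i * k + r + 1\<close>; in the second
    \<open>m - i\<close> is at most 0 and w is positive.\<close>
  have l: "m < i * (k - 1) \<or> k = 2 \<and> m \<le> i" if "l < i" for i
  proof (cases "k = 2")
    case True
    then show ?thesis
      using that by (simp add: l_def)
  next
    case False
    then have "(of_int m :: rat) / of_int (k - 1) < of_int i"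
      using that by (simp add: l_def floor_less_iff)
    then have "(of_int m :: rat) < of_int (i * (k - 1))"
      using assms by (simp add: divide_less_eq)
    then show ?thesis
      unfolding of_int_less_iff by blast
  qed
  have "(of_int (gen_fib_neg k (m * k + r)) :: rat) =
      (\<Sum>i\<in>{0..l}. fib_term (m - i) (i * k + r + 1))"
  proof (rule gen_fib_neg_expansion)
    fix i :: int assume i: "0 \<le> i" "l < i"
    show "m - i < i * k + r + 1"
      using l[OF i(2)]
    proof
      assume "m < i * (k - 1)"
      then show ?thesis
        using i r by (simp add: algebra_simps)
    next
      assume "k = 2 \<and> m \<le> i"
      then show ?thesis
        using i r m by auto
    qed
  qed (use assms r m in auto)
  also have "\<dots> = (\<Sum>i\<in>{0..l}. (-1) powi (i * k + r + 1)
      * of_int (int_binom (m - i - 1) (i * k + r) + int_binom (m - i) (i * k + r + 1))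
      * 2 powi (m - i * (k + 1) - r - 2))"
  proof (rule sum.cong[OF refl])
    fix i :: int
    have "m - i - (i * k + r + 1) - 1 = m - i * (k + 1) - r - 2"
      by (simp add: algebra_simps)
    then show "fib_term (m - i) (i * k + r + 1) = (-1) powi (i * k + r + 1)
        * of_int (int_binom (m - i - 1) (i * k + r) + int_binom (m - i) (i * k + r + 1))
        * 2 powi (m - i * (k + 1) - r - 2)"
      by (simp only: fib_term_def add_diff_cancel_right')
  qed
  finally show "let l = (if k = 2 then m - 1 else \<lfloor>(of_int m :: rat) / of_int (k - 1)\<rfloor>)
    in (of_int (gen_fib_neg k (m * k + r)) :: rat) =
      (\<Sum>i\<in>{0..l}. (-1) powi (i * k + r + 1)
        * of_int (int_binom (m - i - 1) (i * k + r) + int_binom (m - i) (i * k + r + 1))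
        * 2 powi (m - i * (k + 1) - r - 2))"
    unfolding Let_def l_def .
qed

end
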